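(* There is an instance $I$ of the unconstrained bipartite $b$-matching game such that $D(I)\subsetneq C(I)$, i.e. $I$ has core imputations that do not correspond to optimal solutions of the dual linear program.
   Context: An instance $I$ of the unconstrained bipartite $b$-matching game consists of a finite bipartite graph $G=(U,V,E)$, weights $w:E\to\mathbb{R}_{\ge 0}$, and $b:U\cup V\to\mathbb{Z}_{\ge 0}$. The players are the vertices. An (unconstrained) $b$-matching assigns to each edge a non-negative integer multiplicity $x_{ij}$ so that the total multiplicity of edges at each vertex $q$ is at most $b_q$; its weight is $\sum_{(i,j)}w_{ij}x_{ij}$. The worth $p(S_u\cup S_v)$ of a coalition ($S_u\subseteq U,S_v\subseteq V$) is the weight of a maximum weight such $b$-matching in the subgraph induced on $S_u\cup S_v$. An imputation is a pair $\alpha:U\to\mathbb{R}_{\ge 0}$, $\beta:V\to\mathbb{R}_{\ge 0}$ with $\sum_{i\in U}\alpha_i+\sum_{j\in V}\beta_j=p(U\cup V)$. It is in the core if $\sum_{i\in S_u}\alpha_i+\sum_{j\in S_v}\beta_j\ge p(S_u\cup S_v)$ for every coalition. $C(I)$ denotes the set of all core imputations of $I$. The dual linear program is: minimize $\sum_{i\in U}b_iu_i+\sum_{j\in V}b_jv_j$ subject to $u_i+v_j\ge w_{ij}$ for all $(i,j)\in E$, $u_i\ge 0$ for all $i\in U$, $v_j\ge 0$ for all $j\in V$. $D(I)$ denotes the set of core imputations of the form $\alpha_i=b_iu_i$, $\beta_j=b_jv_j$ where $(u,v)$ ranges over the optimal solutions of this dual program. *)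

theory Defs
  imports Complex_Main "HOL-Library.FuncSet"
begin

record 'a b_instance =
  left_side :: "'a set"
  right_side :: "'a set"
  edges :: "('a \<times> 'a) set"
  weight :: "'a \<times> 'a \<Rightarrow> real"
  capacity :: "'a \<Rightarrow> nat"

text \<open>An edge is an ordered pair (left endpoint, right endpoint).\<close>

definition b_matching_instance :: "'a b_instance \<Rightarrow> bool" where
  "b_matching_instance I \<longleftrightarrow>
     finite (left_side I) \<and> finite (right_side I) \<and> left_side I \<inter> right_side I = {} \<and>
     edges I \<subseteq> left_side I \<times> right_side I \<and> (\<forall>e\<in>edges I. weight I e \<ge> 0)"

definition induced_edges :: "'a b_instance \<Rightarrow> 'a set \<Rightarrow> 'a set \<Rightarrow> ('a \<times> 'a) set" where
  "induced_edges I Su Sv = edges I \<inter> (Su \<times> Sv)"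

definition b_matchings :: "'a b_instance \<Rightarrow> 'a set \<Rightarrow> 'a set \<Rightarrow> ('a \<times> 'a \<Rightarrow> nat) set" where
  "b_matchings I Su Sv =
     {x \<in> induced_edges I Su Sv \<rightarrow>\<^sub>E UNIV.
        \<forall>q\<in>Su \<union> Sv. (\<Sum>e | e \<in> induced_edges I Su Sv \<and> (fst e = q \<or> snd e = q). x e) \<le> capacity I q}"

definition matching_weight :: "'a b_instance \<Rightarrow> 'a set \<Rightarrow> 'a set \<Rightarrow> ('a \<times> 'a \<Rightarrow> nat) \<Rightarrow> real" where
  "matching_weight I Su Sv x = (\<Sum>e\<in>induced_edges I Su Sv. weight I e * real (x e))"

definition worth :: "'a b_instance \<Rightarrow> 'a set \<Rightarrow> 'a set \<Rightarrow> real" where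
  "worth I Su Sv = Max (matching_weight I Su Sv ` b_matchings I Su Sv)"

text \<open>The maximum above ranges over a finite nonempty set.\<close>

lemma b_matchings_nonempty:
  "(\<lambda>e\<in>induced_edges I Su Sv. 0) \<in> b_matchings I Su Sv"
  by (auto simp: b_matchings_def intro!: sum.neutral)

lemma finite_b_matchings:
  assumes "b_matching_instance I" "Su \<subseteq> left_side I" "Sv \<subseteq> right_side I"
  shows "finite (b_matchings I Su Sv)"
proof -
  let ?F = "induced_edges I Su Sv"
  have fin: "finite ?F"
    using assms unfolding b_matching_instance_def induced_edges_def
    by (meson finite_Int finite_SigmaI finite_subset)
  have "b_matchings I Su Sv \<subseteq> (\<Pi>\<^sub>E e\<in>?F. {..capacity I (fst e)})"
  proof
    fix x assume x: "x \<in> b_matchings I Su Sv"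
    have "x e \<le> capacity I (fst e)" if e: "e \<in> ?F" for e
    proof -
      have "fst e \<in> Su \<union> Sv" using e by (auto simp: induced_edges_def)
      then have le: "(\<Sum>e' | e' \<in> ?F \<and> (fst e' = fst e \<or> snd e' = fst e). x e') \<le> capacity I (fst e)"
        using x by (simp add: b_matchings_def)
      have "x e \<le> (\<Sum>e' | e' \<in> ?F \<and> (fst e' = fst e \<or> snd e' = fst e). x e')"
        using e fin by (intro member_le_sum) auto
      then show ?thesis using le by simp
    qed
    then show "x \<in> (\<Pi>\<^sub>E e\<in>?F. {..capacity I (fst e)})"
      using x by (auto simp: b_matchings_def PiE_iff)
  qed
  then show ?thesis
    using fin by (meson finite_PiE finite_atMost finite_subset)
qed

text \<open>Payoffs are functions on the two sides, represented as extensional functions so that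
  equality of payoffs, and hence strict inclusion below, only depends on the values at players.\<close>

definition imputations :: "'a b_instance \<Rightarrow> (('a \<Rightarrow> real) \<times> ('a \<Rightarrow> real)) set" where
  "imputations I =
     {(\<alpha>, \<beta>). \<alpha> \<in> left_side I \<rightarrow>\<^sub>E {0..} \<and> \<beta> \<in> right_side I \<rightarrow>\<^sub>E {0..} \<and>
        (\<Sum>i\<in>left_side I. \<alpha> i) + (\<Sum>j\<in>right_side I. \<beta> j) = worth I (left_side I) (right_side I)}"

definition core_imputations :: "'a b_instance \<Rightarrow> (('a \<Rightarrow> real) \<times> ('a \<Rightarrow> real)) set" where
  "core_imputations I =
     {(\<alpha>, \<beta>) \<in> imputations I.
        \<forall>Su Sv. Su \<subseteq> left_side I \<longrightarrow> Sv \<subseteq> right_side I \<longrightarrow>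
          (\<Sum>i\<in>Su. \<alpha> i) + (\<Sum>j\<in>Sv. \<beta> j) \<ge> worth I Su Sv}"

definition dual_feasible :: "'a b_instance \<Rightarrow> ('a \<Rightarrow> real) \<Rightarrow> ('a \<Rightarrow> real) \<Rightarrow> bool" where
  "dual_feasible I u v \<longleftrightarrow>
     (\<forall>(i, j)\<in>edges I. u i + v j \<ge> weight I (i, j)) \<and>
     (\<forall>i\<in>left_side I. u i \<ge> 0) \<and> (\<forall>j\<in>right_side I. v j \<ge> 0)"

definition dual_objective :: "'a b_instance \<Rightarrow> ('a \<Rightarrow> real) \<Rightarrow> ('a \<Rightarrow> real) \<Rightarrow> real" where
  "dual_objective I u v =
     (\<Sum>i\<in>left_side I. real (capacity I i) * u i) + (\<Sum>j\<in>right_side I. real (capacity I j) * v j)"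

definition dual_optimal :: "'a b_instance \<Rightarrow> ('a \<Rightarrow> real) \<Rightarrow> ('a \<Rightarrow> real) \<Rightarrow> bool" where
  "dual_optimal I u v \<longleftrightarrow>
     dual_feasible I u v \<and>
     (\<forall>u' v'. dual_feasible I u' v' \<longrightarrow> dual_objective I u v \<le> dual_objective I u' v')"

definition dual_core_imputations :: "'a b_instance \<Rightarrow> (('a \<Rightarrow> real) \<times> ('a \<Rightarrow> real)) set" where
  "dual_core_imputations I =
     {(\<alpha>, \<beta>) \<in> core_imputations I. \<exists>u v. dual_optimal I u v \<and>
        (\<forall>i\<in>left_side I. \<alpha> i = real (capacity I i) * u i) \<and>
        (\<forall>j\<in>right_side I. \<beta> j = real (capacity I j) * v j)}"

end

theory Submission
  imports Defs
begin

text \<open>On a single edge of weight 1 whose endpoints have capacities 1 and 2, the only constraint on a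
  core imputation is \<open>\<alpha> + \<beta> = 1\<close>. Dual feasibility of \<open>(\<alpha>, \<beta> / 2)\<close> demands \<open>\<alpha> + \<beta> / 2 \<ge> 1\<close>, which
  fails for the core imputation giving everything to the vertex of capacity 2.\<close>

definition edge_instance :: "nat b_instance" where
  "edge_instance = \<lparr>left_side = {0}, right_side = {2}, edges = {(0, 2)},
     weight = (\<lambda>_. 1), capacity = (\<lambda>q. if q = 0 then 1 else 2)\<rparr>"

lemma edge_instance_valid: "b_matching_instance edge_instance"
  by (simp add: b_matching_instance_def edge_instance_def)

text \<open>Since \<open>worth\<close> is a \<open>Max\<close> over a finite nonempty set, bounding
  it amounts to bounding every single b-matching.\<close>

lemma worth_le:
  assumes "b_matching_instance I" "Su \<subseteq> left_side I" "Sv \<subseteq> right_side I"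
    and "\<And>x. x \<in> b_matchings I Su Sv \<Longrightarrow> matching_weight I Su Sv x \<le> c"
  shows "worth I Su Sv \<le> c"
  unfolding worth_def
  using finite_b_matchings[OF assms(1-3)] b_matchings_nonempty[of I Su Sv] assms(4)
  by (subst Max_le_iff) auto

lemma worth_ge:
  assumes "b_matching_instance I" "Su \<subseteq> left_side I" "Sv \<subseteq> right_side I"
    and "x \<in> b_matchings I Su Sv"
  shows "matching_weight I Su Sv x \<le> worth I Su Sv"
  unfolding worth_def using finite_b_matchings[OF assms(1-3)] assms(4) by simp

lemma worth_no_edges:
  assumes "b_matching_instance I" "Su \<subseteq> left_side I" "Sv \<subseteq> right_side I"
    and "induced_edges I Su Sv = {}"
  shows "worth I Su Sv \<le> 0"
  by (rule worth_le[OF assms(1-3)]) (simp add: matching_weight_def assms(4))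

lemma induced_edges_edge_instance: "induced_edges edge_instance {0} {2} = {(0, 2)}"
  by (auto simp: induced_edges_def edge_instance_def)

text \<open>Vertex \<open>0\<close> has capacity 1, so the edge is used at most once; the second
  unit of capacity at vertex \<open>2\<close> earns nothing.\<close>

lemma worth_edge_instance: "worth edge_instance {0} {2} = 1"
proof (rule antisym)
  have sides: "{0} \<subseteq> left_side edge_instance" "{2} \<subseteq> right_side edge_instance"
    by (simp_all add: edge_instance_def)
  \<comment> \<open>The load at either endpoint is thus the single term
    \<open>x (0, 2)\<close>.\<close>
  have at_vertex: "{e. e = (0::nat, 2::nat) \<and> (fst e = q \<or> snd e = q)} = {(0, 2)}"
    if "q \<in> {0, 2}" for q
    using that by auto
  show "worth edge_instance {0} {2} \<le> 1"
  proof (rule worth_le[OF edge_instance_valid sides])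
    fix x assume "x \<in> b_matchings edge_instance {0} {2}"
    then have "x (0, 2) \<le> 1"
      using at_vertex[of 0]
      by (simp add: b_matchings_def induced_edges_edge_instance) (simp add: edge_instance_def)
    then show "matching_weight edge_instance {0} {2} x \<le> 1"
      by (simp add: matching_weight_def induced_edges_edge_instance) (simp add: edge_instance_def)
  qed
  \<comment> \<open>Taking the edge once respects both capacities and attains the bound.\<close>
  have "(\<lambda>e\<in>{(0, 2)}. 1) \<in> b_matchings edge_instance {0} {2}"
    using at_vertex[of 0] at_vertex[of 2]
    by (simp add: b_matchings_def induced_edges_edge_instance) (simp add: edge_instance_def)
  from worth_ge[OF edge_instance_valid sides this]
  show "1 \<le> worth edge_instance {0} {2}"
    by (simp add: matching_weight_def induced_edges_edge_instance) (simp add: edge_instance_def)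
qed

lemma core_imputation_edge_instance:
  "(\<lambda>i\<in>{0}. 0, \<lambda>j\<in>{2}. 1) \<in> core_imputations edge_instance"
proof -
  have "worth edge_instance Su Sv \<le> (\<Sum>i\<in>Su. (\<lambda>i\<in>{0}. 0) i) + (\<Sum>j\<in>Sv. (\<lambda>j\<in>{2}. 1) j)"
    if S: "Su \<subseteq> {0}" "Sv \<subseteq> {2}" for Su Sv
  \<comment> \<open>A coalition missing one side contains no edge; the only other coalition is the
    grand one, where the core inequality is an equality.\<close>
  proof (cases "Su = {} \<or> Sv = {}")
    case True
    then have "induced_edges edge_instance Su Sv = {}"
      by (auto simp: induced_edges_def)
    then have "worth edge_instance Su Sv \<le> 0"
      using S by (intro worth_no_edges edge_instance_valid) (auto simp: edge_instance_def)
    also have "0 \<le> (\<Sum>i\<in>Su. (\<lambda>i\<in>{0}. 0) i) + (\<Sum>j\<in>Sv. (\<lambda>j\<in>{2}. 1::real) j)"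
      \<comment> \<open>The inclusions \<open>S\<close> matter here: away from the players the
        payoffs are \<open>undefined\<close>, with no known sign.\<close>
      using S by (intro add_nonneg_nonneg sum_nonneg) auto
    finally show ?thesis .
  next
    case False
    with S have "Su = {0}" "Sv = {2}" by auto
    then show ?thesis using worth_edge_instance by simp
  qed
  then show ?thesis
    using worth_edge_instance
    by (auto simp: core_imputations_def imputations_def edge_instance_def)
qed

text \<open>Dividing the payoffs by the capacities forces \<open>u 0 = 0\<close> and
  \<open>v 2 = 1/2\<close>, whose sum is below the edge weight 1.\<close>

lemma not_dual_core_imputation_edge_instance:
  "(\<lambda>i\<in>{0}. 0, \<lambda>j\<in>{2}. 1) \<notin> dual_core_imputations edge_instance"
  by (auto simp: dual_core_imputations_def dual_optimal_def dual_feasible_def edge_instance_def)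

theorem mainTheorem7:
  shows "\<exists>I :: nat b_instance. b_matching_instance I \<and> dual_core_imputations I \<subset> core_imputations I"
proof (intro exI conjI psubsetI)
  show "b_matching_instance edge_instance" by (rule edge_instance_valid)
  show "dual_core_imputations edge_instance \<subseteq> core_imputations edge_instance"
    by (auto simp: dual_core_imputations_def)
  show "dual_core_imputations edge_instance \<noteq> core_imputations edge_instance"
    using core_imputation_edge_instance not_dual_core_imputation_edge_instance by auto
qed

end
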